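(* Let $n$, $t$ and $s$ be positive integers with $n\geq t+s+2$. Suppose $\mathcal{F}\subseteq \binom{[n]}{t+1}$ is an $s$-almost $t$-intersecting family which is not $t$-intersecting, and that $\mathcal{F}$ has the maximum size among all $s$-almost $t$-intersecting subfamilies of $\binom{[n]}{t+1}$ that are not $t$-intersecting. Then one of the following holds. (i) $s=1$ and $\mathcal{F}\cong\left\{ F\in\binom{[t+3]}{t+1}:[t-1]\subseteq F\right\}$. (ii) $s=3$ and $\mathcal{F}\cong\left\{ F\in\binom{[t+4]}{t+1}:[t-1]\subseteq F\right\}$. (iii) $s=3$, $t\geq 2$ and $\mathcal{F}\cong\left\{ F\in \binom{[t+3]}{t+1}: [t-2]\subseteq F\right\}$. (iv) $s=6$ and $\mathcal{F}\cong\left\{F\in\binom{[t+5]}{t+1}:[t-1]\subseteq F\right\}$. (v) $s=6$, $t\geq 3$ and $\mathcal{F}\cong\left\{F\in \binom{[t+3]}{t+1}:[t-3]\subseteq F\right\}$. (vi) $s\neq 1,3$ and $\mathcal{F}\cong\left\{F\in \binom{[t+s+2]}{t+1}: [t-1]\subseteq F,\ \left|F\cap [t+1]\right|\geq t\right\}$. (vii) $s\neq 1,3$, $t\geq s$ and $\mathcal{F}\cong\left\{ F\in \binom{[t+3]}{t+1}: [t-s]\subseteq F,\ \left|F\cap [t+1]\right|\geq t\right\}$.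
   Context: $[m]=\{1,\dots,m\}$ (with $[m]=\emptyset$ for $m\leq 0$) and $\binom{X}{k}$ denotes the family of all $k$-subsets of a set $X$. A family $\mathcal{F}\subseteq\binom{[n]}{k}$ is called $s$-almost $t$-intersecting if $\left|\{F'\in\mathcal{F}: |F'\cap F|<t\}\right|\leq s$ for every $F\in\mathcal{F}$; it is $t$-intersecting if $|F\cap F'|\geq t$ for all $F,F'\in\mathcal{F}$. $\mathcal{F}\cong\mathcal{G}$ means there is a permutation of $[n]$ mapping $\mathcal{F}$ onto $\mathcal{G}$. *)

theory Defs
  imports "HOL-Library.Ramsey" "HOL-Combinatorics.Permutations"
begin

text \<open>Both notions below are meant for finite families of
  finite sets, since \<^const>\<open>card\<close> is 0 on infinite sets. The family of \<open>k\<close>-subsets of \<open>X\<close> is the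
  library's \<open>[X]\<^bsup>k\<^esup>\<close> (\<^const>\<open>nsets\<close>).\<close>

definition t_intersecting :: "nat \<Rightarrow> 'a set set \<Rightarrow> bool" where
  "t_intersecting t \<F> \<longleftrightarrow> (\<forall>F\<in>\<F>. \<forall>F'\<in>\<F>. card (F \<inter> F') \<ge> t)"

definition almost_t_intersecting :: "nat \<Rightarrow> nat \<Rightarrow> 'a set set \<Rightarrow> bool" where
  "almost_t_intersecting s t \<F> \<longleftrightarrow> (\<forall>F\<in>\<F>. card {F'\<in>\<F>. card (F' \<inter> F) < t} \<le> s)"

definition family_iso :: "nat \<Rightarrow> nat set set \<Rightarrow> nat set set \<Rightarrow> bool" where
  "family_iso n \<F> \<G> \<longleftrightarrow> (\<exists>\<pi>. \<pi> permutes {1..n} \<and> (\<lambda>F. \<pi> ` F) ` \<F> = \<G>)"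

end

theory Submission
  imports Defs
begin

text \<open>View \<open>\<F>\<close> as a set of vertices of the Johnson graph of \<open>(t+1)\<close>-sets, where each vertex has at
  most \<open>s\<close> non-neighbours in \<open>\<F>\<close>. Family (vi) always has \<open>2s + 3\<close> members, so \<open>|\<F>| \<ge> 2s + 3\<close>, while
  two non-adjacent vertices \<open>A\<close>, \<open>B\<close> have at most four common neighbours. Hence
  \<open>|A \<inter> B| = t - 1\<close>, and the number of common neighbours missing from \<open>\<F>\<close> plus the number of members
  non-adjacent to both \<open>A\<close> and \<open>B\<close> is at most one. This rigidity forces either all members to contain
  \<open>Z = A \<inter> B\<close> or all members to lie in \<open>Y = A \<union> B\<close>; replacing \<open>F\<close> by \<open>F - Z\<close> or \<open>Y - F\<close> turns \<open>\<F>\<close> into a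
  graph in which non-adjacency becomes disjointness of edges. In this graph two disjoint edges span at
  least five edges, so it consists of \<open>r\<close> universal vertices joined to an independent set of \<open>c\<close>
  vertices, and counting edges leaves \<open>K\<^sub>4\<close>, \<open>K\<^sub>5\<close>, \<open>K\<^sub>6\<close>, the case \<open>r = 2\<close>, \<open>c = s + 1\<close>, and \<open>K\<^sub>5\<close> minus
  an edge with \<open>s = 3\<close>, which is beaten by \<open>K\<^sub>5\<close>.\<close>

section \<open>Common neighbours of two far members\<close>

text \<open>A member that is not a common neighbour is far from \<open>A\<close> or from
  \<open>B\<close>. Each far set has at most \<open>s\<close> elements, and inclusion-exclusion on
  the two leaves a surplus of three plus the size of their overlap.\<close>

lemma common_neighbours_card:
  assumes "finite \<F>" "almost_t_intersecting s t \<F>" "A \<in> \<F>" "B \<in> \<F>" "2 * s + 3 \<le> card \<F>"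
  shows "3 + card {G \<in> \<F>. card (G \<inter> A) < t \<and> card (G \<inter> B) < t}
           \<le> card {G \<in> \<F>. t \<le> card (G \<inter> A) \<and> t \<le> card (G \<inter> B)}"
proof -
  define D where "D X = {G \<in> \<F>. card (G \<inter> X) < t}" for X
  define N where "N = {G \<in> \<F>. t \<le> card (G \<inter> A) \<and> t \<le> card (G \<inter> B)}"
  have D: "card (D A) \<le> s" "card (D B) \<le> s"
    using assms unfolding almost_t_intersecting_def D_def by auto
  have fin: "finite (D X)" "finite N" for X
    using assms(1) by (auto simp: D_def N_def)
  have "\<F> = (D A \<union> D B) \<union> N" "(D A \<union> D B) \<inter> N = {}"
    by (auto simp: D_def N_def)
  then have "card \<F> = card (D A \<union> D B) + card N"
    using fin by (metis card_Un_disjoint finite_UnI)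
  moreover have "card (D A) + card (D B) = card (D A \<union> D B) + card (D A \<inter> D B)"
    using fin by (intro card_Un_Int) auto
  moreover have "D A \<inter> D B = {G \<in> \<F>. card (G \<inter> A) < t \<and> card (G \<inter> B) < t}"
    by (auto simp: D_def)
  ultimately show ?thesis
    using D assms(5) unfolding N_def by simp
qed

lemma card_Int_add_card_Int:
  assumes "finite G"
  shows "card (G \<inter> A) + card (G \<inter> B) = card (G \<inter> (A \<union> B)) + card (G \<inter> (A \<inter> B))"
proof -
  have "card (G \<inter> A) + card (G \<inter> B) = card ((G \<inter> A) \<union> (G \<inter> B)) + card ((G \<inter> A) \<inter> (G \<inter> B))"
    using assms by (intro card_Un_Int) auto
  then show ?thesis
    by (simp add: Int_Un_distrib Int_ac)
qed

text \<open>The sum \<open>card (G \<inter> A) + card (G \<inter> B)\<close> is at least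
  \<open>2 * t\<close>, but modularity bounds it by \<open>(t + 1) + (t - 1)\<close>. Equality
  therefore holds throughout: \<open>G\<close> contains the intersection, lies in the union and
  takes one further element from each side.\<close>

lemma common_neighbour_form:
  assumes fin: "finite A" "finite B" "finite G"
    and card: "card A = t + 1" "card B = t + 1" "card G = t + 1"
    and AB: "card (A \<inter> B) < t" and GA: "t \<le> card (G \<inter> A)" and GB: "t \<le> card (G \<inter> B)"
  shows "card (A \<inter> B) + 1 = t" "\<exists>a \<in> A - B. \<exists>b \<in> B - A. G = A \<inter> B \<union> {a, b}"
proof -
  note sum = card_Int_add_card_Int[OF fin(3), of A B]
  have le1: "card (G \<inter> (A \<union> B)) \<le> t + 1"
    using fin card by (metis Int_lower1 card_mono)
  have le2: "card (G \<inter> (A \<inter> B)) \<le> card (A \<inter> B)"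
    using fin by (intro card_mono) auto
  show 1: "card (A \<inter> B) + 1 = t"
    using sum le1 le2 AB GA GB by linarith
  have eq: "card (G \<inter> (A \<union> B)) = t + 1" "card (G \<inter> (A \<inter> B)) = card (A \<inter> B)"
    using sum le1 le2 AB GA GB by linarith+
  have sub1: "G \<subseteq> A \<union> B"
    using eq(1) card fin by (metis Int_lower1 card_subset_eq inf.absorb_iff1)
  have sub2: "A \<inter> B \<subseteq> G"
    using eq(2) fin by (metis Int_lower2 card_subset_eq finite_Int inf.absorb_iff2)
  have GAB: "card (G \<inter> A) = t" "card (G \<inter> B) = t"
    using sum eq 1 GA GB by linarith+
  have diff: "card (G \<inter> (X - Y)) = 1" if "card (G \<inter> X) = t" "X \<inter> Y = A \<inter> B" "finite X" for X Y
  proof -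
    have "G \<inter> (X - Y) = G \<inter> X - (A \<inter> B)" using that(2) by auto
    moreover have "A \<inter> B \<subseteq> G \<inter> X" using sub2 that(2) by auto
    ultimately show ?thesis
      using that 1 fin by (simp add: card_Diff_subset)
  qed
  obtain a where a: "G \<inter> (A - B) = {a}"
    using diff[of A B] GAB fin by (auto simp: card_1_singleton_iff)
  obtain b where b: "G \<inter> (B - A) = {b}"
    using diff[of B A] GAB fin by (auto simp: card_1_singleton_iff Int_commute)
  have "G = A \<inter> B \<union> {a, b}"
    using sub1 sub2 a b by blast
  then show "\<exists>a \<in> A - B. \<exists>b \<in> B - A. G = A \<inter> B \<union> {a, b}"
    using a b by blast
qed

text \<open>Two sets of the family with small intersection span, together with their four common
  neighbours, an octahedron of the Johnson graph; at most one of its vertices is missing from the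
  family, and none if some member is far from both sets.\<close>

lemma octahedron:
  assumes uniform: "finite \<F>" "\<forall>F\<in>\<F>. finite F \<and> card F = t + 1"
    and al: "almost_t_intersecting s t \<F>" and big: "2 * s + 3 \<le> card \<F>"
    and AB: "A \<in> \<F>" "B \<in> \<F>" "card (A \<inter> B) < t"
  shows "card (A \<inter> B) + 1 = t"
    and "card {(a, b) \<in> (A - B) \<times> (B - A). A \<inter> B \<union> {a, b} \<notin> \<F>}
           + card {G \<in> \<F>. card (G \<inter> A) < t \<and> card (G \<inter> B) < t} \<le> 1"
proof -
  note F = uniform(1) bspec[OF uniform(2)]
  define N where "N = {G \<in> \<F>. t \<le> card (G \<inter> A) \<and> t \<le> card (G \<inter> B)}"
  note count = common_neighbours_card[OF uniform(1) al AB(1,2) big, folded N_def]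
  have AB': "finite A" "finite B" "card A = t + 1" "card B = t + 1"
    using F AB by auto
  have form: "card (A \<inter> B) + 1 = t" "\<exists>a \<in> A - B. \<exists>b \<in> B - A. G = A \<inter> B \<union> {a, b}" if "G \<in> N" for G
    using common_neighbour_form[of A B G t] that F(2)[of G] AB' AB(3) by (auto simp: N_def)
  have "N \<noteq> {}"
    using count by auto
  then show 1: "card (A \<inter> B) + 1 = t"
    using form by blast
  define P where "P = (A - B) \<times> (B - A)"
  define Q where "Q = {(a, b) \<in> P. A \<inter> B \<union> {a, b} \<in> \<F>}"
  define R where "R = {(a, b) \<in> P. A \<inter> B \<union> {a, b} \<notin> \<F>}"
  have finP: "finite P"
    using AB' by (simp add: P_def)
  have "card (A - B) = 2" "card (B - A) = 2"
    using AB' 1 by (auto simp: card_Diff_subset_Int Int_commute)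
  then have "card P = 4"
    by (simp add: P_def card_cartesian_product)
  moreover have "P = Q \<union> R" "Q \<inter> R = {}"
    by (auto simp: Q_def R_def)
  ultimately have "card Q + card R = 4"
    using finP by (metis card_Un_disjoint finite_Un)
  \<comment> \<open>\<open>Q\<close> and \<open>R\<close> split the four pairs, so
    \<open>card N\<close> is at most \<open>4 - card R\<close>; the surplus of three then leaves
    room for one exception only.\<close>
  moreover have "N \<subseteq> (\<lambda>(a, b). A \<inter> B \<union> {a, b}) ` Q"
  proof
    fix G assume "G \<in> N"
    then obtain a b where "a \<in> A - B" "b \<in> B - A" "G = A \<inter> B \<union> {a, b}" "G \<in> \<F>"
      using form(2)[of G] by (auto simp: N_def)
    then have "(a, b) \<in> Q" "G = (\<lambda>(a, b). A \<inter> B \<union> {a, b}) (a, b)"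
      by (auto simp: Q_def P_def)
    then show "G \<in> (\<lambda>(a, b). A \<inter> B \<union> {a, b}) ` Q"
      by blast
  qed
  then have "card N \<le> card Q"
    using finP \<open>P = Q \<union> R\<close> by (intro surj_card_le) auto
  ultimately show "card {(a, b) \<in> (A - B) \<times> (B - A). A \<inter> B \<union> {a, b} \<notin> \<F>}
           + card {G \<in> \<F>. card (G \<inter> A) < t \<and> card (G \<inter> B) < t} \<le> 1"
    using count unfolding R_def P_def by linarith
qed

section \<open>Common core or common hull\<close>

text \<open>If both inclusions failed, modularity would bound the sum of the two intersection sizes
  by \<open>t + (t - 2)\<close>, one below the assumed \<open>t + (t - 1)\<close>.\<close>

lemma Int_subset_or_subset_Un:
  assumes fin: "finite A" "finite B" "finite G" "card G = t + 1"
    and "card (A \<inter> B) + 1 = t" "t \<le> card (G \<inter> A)" "t \<le> card (G \<inter> B) + 1"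
  shows "A \<inter> B \<subseteq> G \<or> G \<subseteq> A \<union> B"
proof (rule ccontr)
  assume "\<not> ?thesis"
  then have "G \<inter> (A \<union> B) \<subset> G" "G \<inter> (A \<inter> B) \<subset> A \<inter> B"
    by blast+
  then have "card (G \<inter> (A \<union> B)) < t + 1" "card (G \<inter> (A \<inter> B)) < card (A \<inter> B)"
    using fin by (metis psubset_card_mono, metis psubset_card_mono finite_Int)
  then show False
    using card_Int_add_card_Int[OF fin(3), of A B] assms by linarith
qed

text \<open>A violating \<open>G\<close> is far from both \<open>A\<close> and \<open>B\<close>, so
  their octahedron lies entirely in the family. The same argument at every antipodal pair shows that
  \<open>G\<close> meets all six vertices in \<open>t - 1\<close> elements, so it contains all or
  none of the four elements of the symmetric difference. Either outcome gives one of the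
  inclusions.\<close>

lemma member_contains_Int_or_subset_Un:
  assumes uniform: "finite \<F>" "\<forall>F\<in>\<F>. finite F \<and> card F = t + 1"
    and al: "almost_t_intersecting s t \<F>" and big: "2 * s + 3 \<le> card \<F>"
    and AB: "A \<in> \<F>" "B \<in> \<F>" "card (A \<inter> B) < t" and G: "G \<in> \<F>"
  shows "A \<inter> B \<subseteq> G \<or> G \<subseteq> A \<union> B"
proof (rule ccontr)
  note F = uniform(1) bspec[OF uniform(2)]
  assume neg: "\<not> ?thesis"
  note oct = octahedron[OF uniform al big]
  have far: "t \<le> card (X \<inter> Y) + 1" if "X \<in> \<F>" "Y \<in> \<F>" for X Y
    using oct(1)[OF that] by linarith
  have fin: "finite A" "finite B" "finite G" "card A = t + 1" "card B = t + 1" "card G = t + 1"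
    using F AB G by auto
  have AB1: "card (A \<inter> B) + 1 = t"
    using oct(1)[OF AB] .
  \<comment> \<open>Only the intersection and the union of the pair enter, so this applies to every
    antipodal pair of the octahedron and not just to \<open>A\<close>, \<open>B\<close>.\<close>
  have exact: "card (G \<inter> X) + 1 = t"
    if "X \<in> \<F>" "Y \<in> \<F>" "X \<inter> Y = A \<inter> B" "X \<union> Y = A \<union> B" for X Y
  proof (rule ccontr)
    assume "card (G \<inter> X) + 1 \<noteq> t"
    then have "t \<le> card (G \<inter> X)"
      using far[OF G that(1)] by linarith
    then have "X \<inter> Y \<subseteq> G \<or> G \<subseteq> X \<union> Y"
      using Int_subset_or_subset_Un[of X Y G t] F(2)[OF that(1)] F(2)[OF that(2)] fin far[OF G that(2)] AB1 that(3)
      by simp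
    then show False
      using neg that by simp
  qed
  have GA: "card (G \<inter> A) + 1 = t" and GB: "card (G \<inter> B) + 1 = t"
    using exact[of A B] exact[of B A] AB by (auto simp: Int_commute Un_commute)
  \<comment> \<open>\<open>G\<close> itself uses up the single exception that
    \<open>octahedron\<close> allows, so no vertex is missing.\<close>
  then have "G \<in> {G \<in> \<F>. card (G \<inter> A) < t \<and> card (G \<inter> B) < t}"
    using G by simp
  then have "card {G \<in> \<F>. card (G \<inter> A) < t \<and> card (G \<inter> B) < t} \<noteq> 0"
    using F(1) by (auto simp del: mem_Collect_eq)
  then have "card {(a, b) \<in> (A - B) \<times> (B - A). A \<inter> B \<union> {a, b} \<notin> \<F>} = 0"
    using oct(2)[OF AB] by linarith
  moreover have "finite {(a, b) \<in> (A - B) \<times> (B - A). A \<inter> B \<union> {a, b} \<notin> \<F>}"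
    using fin by (auto intro: finite_subset[of _ "(A - B) \<times> (B - A)"])
  ultimately have all: "A \<inter> B \<union> {a, b} \<in> \<F>" if "a \<in> A - B" "b \<in> B - A" for a b
    using that by auto
  have "card (A - B) = 2" "card (B - A) = 2"
    using fin AB1 by (auto simp: card_Diff_subset_Int Int_commute)
  then obtain a a' b b' where ab: "A - B = {a, a'}" "a \<noteq> a'" "B - A = {b, b'}" "b \<noteq> b'"
    by (auto simp: card_2_iff)
  define g where "g = card (G \<inter> (A \<inter> B))"
  define \<iota> where "\<iota> x = (if x \<in> G then 1 else 0 :: nat)" for x
  have cc: "card (G \<inter> (A \<inter> B \<union> {x, y})) = g + \<iota> x + \<iota> y"
    if "x \<notin> A \<inter> B" "y \<notin> A \<inter> B" "x \<noteq> y" for x y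
  proof -
    have "G \<inter> (A \<inter> B \<union> {x, y}) = G \<inter> (A \<inter> B) \<union> ({x, y} \<inter> G)" by auto
    moreover have "card ({x, y} \<inter> G) = \<iota> x + \<iota> y"
      using that by (auto simp: \<iota>_def)
    moreover have "G \<inter> (A \<inter> B) \<inter> ({x, y} \<inter> G) = {}"
      using that by auto
    ultimately show ?thesis
      using fin by (simp add: card_Un_disjoint g_def)
  qed
  have sets: "a \<in> A - B" "a' \<in> A - B" "b \<in> B - A" "b' \<in> B - A"
    using ab by auto
  \<comment> \<open>The antipode of the vertex through \<open>x\<close> and \<open>y\<close> is the
    one through the other two elements \<open>x'\<close> and \<open>y'\<close>.\<close>
  have mix: "g + \<iota> x + \<iota> y + 1 = t" if "x \<in> A - B" "y \<in> B - A" for x y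
  proof -
    have "\<exists>x'. A - B = {x, x'} \<and> x \<noteq> x'"
      using that(1) unfolding ab(1) using ab(2) by (intro exI[of _ "if x = a then a' else a"]) auto
    moreover have "\<exists>y'. B - A = {y, y'} \<and> y \<noteq> y'"
      using that(2) unfolding ab(3) using ab(4) by (intro exI[of _ "if y = b then b' else b"]) auto
    ultimately obtain x' y' where xy: "A - B = {x, x'}" "x \<noteq> x'" "B - A = {y, y'}" "y \<noteq> y'"
      by blast
    have "card (G \<inter> (A \<inter> B \<union> {x, y})) + 1 = t"
    proof (rule exact)
      show "A \<inter> B \<union> {x, y} \<in> \<F>" "A \<inter> B \<union> {x', y'} \<in> \<F>"
        using xy by (auto intro!: all simp del: Un_insert_right)
      show "(A \<inter> B \<union> {x, y}) \<inter> (A \<inter> B \<union> {x', y'}) = A \<inter> B"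
        using xy by auto
      show "A \<inter> B \<union> {x, y} \<union> (A \<inter> B \<union> {x', y'}) = A \<union> B"
        using xy by auto
    qed
    moreover have "x \<noteq> y"
      using that by blast
    ultimately show ?thesis
      using cc[of x y] that by simp
  qed
  have "A \<inter> B \<union> {a, a'} = A"
    using ab by auto
  then have "g + \<iota> a + \<iota> a' + 1 = t"
    using GA cc[of a a'] ab(2) sets by simp
  then have same: "g + 2 * \<iota> a + 1 = t"
    using mix[OF sets(1,3)] mix[OF sets(2,3)] mix[OF sets(1,4)] by linarith
  show False
  proof (cases "a \<in> G")
    case False
    then have "card (G \<inter> (A \<inter> B)) = card (A \<inter> B)"
      using same AB1 by (simp add: \<iota>_def g_def)
    then have "A \<inter> B \<subseteq> G"
      using fin by (metis Int_lower2 card_subset_eq finite_Int inf.absorb_iff2)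
    then show False
      using neg by simp
  next
    \<comment> \<open>Here \<open>g = t - 3\<close>, and the four elements of the symmetric
      difference bring \<open>G\<close> up to \<open>t + 1\<close> elements inside the
      union.\<close>
    case True
    have "card (G \<inter> (A \<union> B)) + g = 2 * g + 4"
      using card_Int_add_card_Int[OF fin(3), of A B] GA GB same True by (simp add: g_def \<iota>_def)
    then have "card (G \<inter> (A \<union> B)) = card G"
      using same True fin by (simp add: \<iota>_def)
    then have "G \<subseteq> A \<union> B"
      using fin by (metis Int_lower1 card_subset_eq inf.absorb_iff1)
    then show False
      using neg by simp
  qed
qed

text \<open>Otherwise some \<open>G\<close> has an element \<open>y\<close> outside the union and
  some \<open>H\<close> misses an element \<open>u\<close> of the intersection. Then
  \<open>u\<close> and \<open>y\<close> both lie in \<open>G - H\<close>, so \<open>G\<close> and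
  \<open>H\<close> are far. The two vertices of their octahedron that keep \<open>y\<close> and drop
  \<open>u\<close> violate the dichotomy, yet only one vertex may be missing.\<close>

lemma sunflower_or_dual:
  assumes uniform: "finite \<F>" "\<forall>F\<in>\<F>. finite F \<and> card F = t + 1"
    and al: "almost_t_intersecting s t \<F>" and big: "2 * s + 3 \<le> card \<F>"
    and AB: "A \<in> \<F>" "B \<in> \<F>" "card (A \<inter> B) < t"
  shows "(\<forall>G\<in>\<F>. A \<inter> B \<subseteq> G) \<or> (\<forall>G\<in>\<F>. G \<subseteq> A \<union> B)"
proof (rule ccontr)
  note F = uniform(1) bspec[OF uniform(2)]
  note dich = member_contains_Int_or_subset_Un[OF uniform al big AB]
  assume "\<not> ?thesis"
  then obtain G H where GH: "G \<in> \<F>" "H \<in> \<F>" "\<not> G \<subseteq> A \<union> B" "\<not> A \<inter> B \<subseteq> H"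
    by blast
  then have sub: "A \<inter> B \<subseteq> G" "H \<subseteq> A \<union> B"
    using dich by blast+
  obtain y where y: "y \<in> G" "y \<notin> A \<union> B"
    using GH by blast
  obtain u where u: "u \<in> A \<inter> B" "u \<notin> H"
    using GH by blast
  have fin: "finite G" "finite H" "card G = t + 1" "card H = t + 1"
    using F GH by auto
  have "card {u, y} \<le> card (G - H)"
    using y u sub fin by (intro card_mono) auto
  moreover have "u \<noteq> y"
    using y u by auto
  then have "card {u, y} = 2"
    by simp
  moreover have "card (G - H) + card (G \<inter> H) = t + 1"
    using fin by (metis card_Diff_subset_Int card_mono finite_Int Int_lower1 le_add_diff_inverse2)
  ultimately have GHt: "card (G \<inter> H) < t"
    by linarith
  note oct = octahedron[OF uniform al big GH(1,2) GHt]
  have "card (H - G) = 2"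
    using fin oct(1) by (simp add: card_Diff_subset_Int Int_commute)
  then obtain p q where pq: "H - G = {p, q}" "p \<noteq> q"
    by (auto simp: card_2_iff)
  have bad: "G \<inter> H \<union> {y, r} \<notin> \<F>" if "r \<in> H - G" for r
  proof
    assume "G \<inter> H \<union> {y, r} \<in> \<F>"
    then have "A \<inter> B \<subseteq> G \<inter> H \<union> {y, r} \<or> G \<inter> H \<union> {y, r} \<subseteq> A \<union> B"
      by (rule dich)
    then show False
      using y u that by auto
  qed
  have "y \<in> G - H"
    using y sub by auto
  then have "{(y, p), (y, q)} \<subseteq> {(a, b) \<in> (G - H) \<times> (H - G). G \<inter> H \<union> {a, b} \<notin> \<F>}"
    using bad pq by blast
  moreover have "finite {(a, b) \<in> (G - H) \<times> (H - G). G \<inter> H \<union> {a, b} \<notin> \<F>}"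
    using fin by (auto intro: finite_subset[of _ "(G - H) \<times> (H - G)"])
  ultimately have "card {(y, p), (y, q)} \<le> card {(a, b) \<in> (G - H) \<times> (H - G). G \<inter> H \<union> {a, b} \<notin> \<F>}"
    by (rule card_mono[rotated])
  then show False
    using oct(2) pq by simp
qed

section \<open>Graphs with few edges disjoint from any given edge\<close>

text \<open>Graphs are treated as families of 2-sets, that is, as the case \<open>t = 1\<close>.\<close>

lemma cross_edges:
  fixes E :: "'a set set"
  assumes E: "finite E" "\<forall>e\<in>E. finite e \<and> card e = 1 + 1"
    and al: "almost_t_intersecting s 1 E" and big: "2 * s + 3 \<le> card E"
    and pa: "{p, a} \<in> E" and qb: "{q, b} \<in> E" and pq: "{p, q} \<notin> E" "p \<noteq> q" "a \<noteq> b"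
  shows "{p, b} \<in> E" "{q, a} \<in> E" "{a, b} \<in> E"
proof -
  have ne: "p \<noteq> a" "q \<noteq> b" "a \<noteq> q" "b \<noteq> p"
    using pa qb pq(1) E(2) by (auto simp: insert_commute)
  then have disj: "{p, a} \<inter> {q, b} = {}"
    using pq by auto
  then have "card ({p, a} \<inter> {q, b}) < 1"
    by simp
  note oct = octahedron(2)[OF E al big pa qb this]
  define M where "M = {(x, y) \<in> ({p, a} - {q, b}) \<times> ({q, b} - {p, a}). {p, a} \<inter> {q, b} \<union> {x, y} \<notin> E}"
  have M: "(x, y) \<in> M \<longleftrightarrow> x \<in> {p, a} \<and> y \<in> {q, b} \<and> {x, y} \<notin> E" for x y
    using disj unfolding M_def by auto
  have "finite M"
    unfolding M_def by (rule finite_subset[of _ "{p, a} \<times> {q, b}"]) auto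
  moreover have "card M \<le> 1"
    using oct unfolding M_def by linarith
  \<comment> \<open>The non-edge \<open>{p, q}\<close> is already the one missing vertex of the
    octahedron, so the other three cross pairs are edges.\<close>
  moreover have "(p, q) \<in> M"
    using M pq by simp
  ultimately have "M = {(p, q)}"
    by (metis One_nat_def card_0_eq card_1_singletonE empty_iff le_Suc_eq le_zero_eq singletonD)
  then have "(p, b) \<notin> M" "(a, q) \<notin> M" "(a, b) \<notin> M"
    using pq ne by auto
  then show "{p, b} \<in> E" "{q, a} \<in> E" "{a, b} \<in> E"
    using M by (auto simp: insert_commute)
qed

text \<open>Two non-adjacent non-isolated vertices are twins whose common neighbourhood is a clique, so
  that the graph is complete multipartite with at most one part of size at least two.\<close>

lemma edges_meeting_universal:
  fixes E :: "'a set set"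
  assumes E: "finite E" "\<forall>e\<in>E. finite e \<and> card e = 1 + 1"
    and al: "almost_t_intersecting s 1 E" and big: "2 * s + 3 \<le> card E"
  shows "\<exists>U \<subseteq> \<Union>E. E = {e \<in> [\<Union>E]\<^bsup>2\<^esup>. e \<inter> U \<noteq> {}} \<and> card (\<Union>E - U) \<noteq> 1"
proof -
  note cross = cross_edges[OF E al big]
  define V where "V = \<Union>E"
  have adj: "x \<noteq> y" "x \<in> V" "y \<in> V" "{y, x} \<in> E" if "{x, y} \<in> E" for x y
    using that E(2) by (auto simp: V_def insert_commute)
  have edgeE: "\<exists>y. {x, y} \<in> E" if "x \<in> V" for x
  proof -
    obtain e where e: "e \<in> E" "x \<in> e" using \<open>x \<in> V\<close> V_def by auto
    then have "card e = 2" using E(2) by auto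
    then show ?thesis
      using e by (metis card_2_iff insertE insert_commute singletonD)
  qed
  \<comment> \<open>Some edge \<open>{q, b}\<close> exists; either \<open>b = a\<close>, or
    \<open>cross\<close> supplies \<open>{q, a}\<close>.\<close>
  have twin: "{q, a} \<in> E" if "p \<noteq> q" "q \<in> V" "{p, q} \<notin> E" "{p, a} \<in> E" for p q a
    using that cross[of p a q] edgeE[of q] by blast
  have clique: "{a, a'} \<in> E"
    if "p \<noteq> q" "q \<in> V" "{p, q} \<notin> E" "{p, a} \<in> E" "{p, a'} \<in> E" "a \<noteq> a'" for p q a a'
    using that cross[of p a q a'] twin[of p q a'] by blast
  define U where "U = {v \<in> V. \<forall>w\<in>V. w \<noteq> v \<longrightarrow> {v, w} \<in> E}"
  \<comment> \<open>If neither end is universal, choose non-neighbours \<open>p\<close> of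
    \<open>x\<close> and \<open>q\<close> of \<open>y\<close>. Twins give the edge
    \<open>{q, x}\<close>, so \<open>y\<close> and \<open>q\<close> are both neighbours of
    \<open>x\<close>; as \<open>x\<close> and \<open>p\<close> are non-adjacent,
    \<open>clique\<close> makes \<open>{y, q}\<close> an edge.\<close>
  have indep: "x \<in> U \<or> y \<in> U" if xy: "{x, y} \<in> E" for x y
  proof (rule ccontr)
    assume "\<not> ?thesis"
    then obtain p q where p: "p \<in> V" "p \<noteq> x" "{x, p} \<notin> E" and q: "q \<in> V" "q \<noteq> y" "{y, q} \<notin> E"
      using adj[OF xy] by (auto simp: U_def)
    have "{q, x} \<in> E"
      using twin[of y q x] q adj[OF xy] by blast
    then show False
      using clique[of x p y q] p q xy adj by blast
  qed
  have "E = {e \<in> [V]\<^bsup>2\<^esup>. e \<inter> U \<noteq> {}}"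
  proof (intro set_eqI iffI)
    fix e assume e: "e \<in> E"
    then obtain x y where xy: "e = {x, y}" "x \<noteq> y"
      using E(2) by (metis card_2_iff one_add_one)
    then show "e \<in> {e \<in> [V]\<^bsup>2\<^esup>. e \<inter> U \<noteq> {}}"
      using e indep[of x y] adj by auto
  next
    fix e assume "e \<in> {e \<in> [V]\<^bsup>2\<^esup>. e \<inter> U \<noteq> {}}"
    then obtain x y where "e = {x, y}" "x \<noteq> y" "x \<in> U" "y \<in> V"
      by (auto simp: nsets_2_eq insert_commute)
    then show "e \<in> E"
      by (auto simp: U_def)
  qed
  \<comment> \<open>The non-neighbour of a non-universal vertex is non-universal too, so such
    vertices never occur alone.\<close>
  moreover have "card (V - U) \<noteq> 1"
  proof
    assume "card (V - U) = 1"
    then obtain x where x: "V - U = {x}"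
      by (auto simp: card_1_singleton_iff)
    then have "x \<in> V" "x \<notin> U"
      by blast+
    then obtain w where "w \<in> V" "w \<noteq> x" "{w, x} \<notin> E"
      by (auto simp: U_def insert_commute)
    then have "w \<in> V - U"
      using \<open>x \<in> V\<close> by (auto simp: U_def)
    then show False
      using x \<open>w \<noteq> x\<close> by auto
  qed
  moreover have "U \<subseteq> V"
    by (auto simp: U_def)
  ultimately show ?thesis
    unfolding V_def by blast
qed

section \<open>Edge counts and the classification of the graphs\<close>

text \<open>For \<open>k = 2\<close>, the choice \<open>e = {}\<close> gives the number of edges and
  an edge \<open>e\<close> gives the number of edges disjoint from it. The subtracted term accounts
  for the sets avoiding \<open>U\<close>.\<close>

lemma card_nsets_diff:
  assumes "finite V"
  shows "card {f \<in> [V]\<^bsup>k\<^esup>. f \<inter> U \<noteq> {} \<and> f \<inter> e = {}} = (card (V - e) choose k) - (card (V - U - e) choose k)"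
proof -
  have nsets: "finite ([X]\<^bsup>k\<^esup>)" "card ([X]\<^bsup>k\<^esup>) = card X choose k" if "finite X" for X
  proof -
    have "[X]\<^bsup>k\<^esup> = {B. B \<subseteq> X \<and> card B = k}"
      using that by (auto simp: nsets_def intro: finite_subset)
    then show "card ([X]\<^bsup>k\<^esup>) = card X choose k"
      using n_subsets[OF that] by simp
  qed (use that in \<open>simp add: finite_imp_finite_nsets\<close>)
  have "{f \<in> [V]\<^bsup>k\<^esup>. f \<inter> U \<noteq> {} \<and> f \<inter> e = {}} = [V - e]\<^bsup>k\<^esup> - [V - U - e]\<^bsup>k\<^esup>"
    by (auto simp: nsets_def)
  moreover have "[V - U - e]\<^bsup>k\<^esup> \<subseteq> [V - e]\<^bsup>k\<^esup>"
    by (rule nsets_mono) auto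
  ultimately show ?thesis
    using assms by (simp add: card_Diff_subset nsets)
qed

lemma nsets_2_meeting_self: "{e \<in> [V]\<^bsup>2\<^esup>. e \<inter> V \<noteq> {}} = [V]\<^bsup>2\<^esup>"
  by (auto simp: nsets_2_eq)

text \<open>Doubling and working over the integers avoids division and truncated subtraction in the
  polynomial estimates.\<close>

lemma twice_choose_two: "2 * int (n choose 2) = int n * (int n - 1)"
proof (induction n)
  case (Suc n)
  then show ?case
    by (simp add: numeral_2_eq_2 algebra_simps)
qed simp

text \<open>With \<open>r\<close> universal and \<open>c\<close> other vertices, bounding the edges
  disjoint from a suitable edge by \<open>s\<close> and comparing with
  \<open>2 * s + 3 \<le> card E\<close> eliminates \<open>s\<close>. A factorised quadratic
  inequality in \<open>r\<close> and \<open>c\<close> remains. The inclusion of \<open>V\<close> in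
  the union of \<open>E\<close> later locates the vertices in the ground set.\<close>

lemma graph_classification:
  fixes E :: "'a set set"
  assumes E: "finite E" "\<forall>e\<in>E. finite e \<and> card e = 1 + 1"
    and al: "almost_t_intersecting s 1 E" and nint: "\<not> t_intersecting 1 E"
    and big: "2 * s + 3 \<le> card E" and big3: "s = 3 \<Longrightarrow> 10 \<le> card E" and big1: "s = 1 \<Longrightarrow> 6 \<le> card E"
  obtains (complete) V where "finite V" "V \<subseteq> \<Union>E" "E = [V]\<^bsup>2\<^esup>"
      "card V = 4 \<and> s = 1 \<or> card V = 5 \<and> s = 3 \<or> card V = 6 \<and> s = 6"
    | (double_star) U V where "finite V" "V \<subseteq> \<Union>E" "U \<subseteq> V" "E = {e \<in> [V]\<^bsup>2\<^esup>. e \<inter> U \<noteq> {}}"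
      "card U = 2" "card V = s + 3" "s \<noteq> 1" "s \<noteq> 3"
proof -
  define V where "V = \<Union>E"
  obtain U where "U \<subseteq> V" "E = {e \<in> [V]\<^bsup>2\<^esup>. e \<inter> U \<noteq> {}}" "card (V - U) \<noteq> 1"
    using edges_meeting_universal[OF E al big, folded V_def] by blast
  note UV = V_def this
  have VE: "V \<subseteq> \<Union>E"
    by (simp add: V_def)
  have finV: "finite V"
    using E UV(1) by auto
  then have finU: "finite U"
    using UV(2) finite_subset by blast
  define r where "r = card U"
  define c where "c = card (V - U)"
  have v: "card V = r + c"
    using finV UV(2) finU by (simp add: r_def c_def card_Diff_subset card_mono)
  have m: "card E = ((r + c) choose 2) - (c choose 2)"
    using card_nsets_diff[OF finV, where U = U and e = "{}" and k = 2] UV(3) v by (simp add: c_def)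
  have deg: "(card (V - e) choose 2) - (card (V - U - e) choose 2) \<le> s" if "e \<in> E" for e
  proof -
    have "{f \<in> E. card (f \<inter> e) < 1} = {f \<in> E. f \<inter> e = {}}"
      using E(2) by auto
    also have "\<dots> = {f \<in> [V]\<^bsup>2\<^esup>. f \<inter> U \<noteq> {} \<and> f \<inter> e = {}}"
      by (subst UV(3)) auto
    finally show ?thesis
      using al that card_nsets_diff[OF finV, where U = U and e = e and k = 2]
      unfolding almost_t_intersecting_def by auto
  qed
  obtain e f where ef: "e \<in> E" "f \<in> E" "e \<inter> f = {}"
    using nint E(2) unfolding t_intersecting_def
    by (metis card_0_eq finite_Int less_one linorder_not_le)
  \<comment> \<open>Every edge meets \<open>U\<close>, so two disjoint edges yield two universal
    vertices.\<close>
  then obtain x y where xy: "x \<in> e \<inter> U" "y \<in> f \<inter> U" "x \<noteq> y"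
    using UV(3) by blast
  have r2: "2 \<le> r"
    using card_mono[of U "{x, y}"] finU xy by (simp add: r_def)
  have v4: "4 \<le> r + c"
  proof -
    have "card (e \<union> f) = 4"
      using ef E(2) by (simp add: card_Un_disjoint)
    moreover have "e \<union> f \<subseteq> V"
      using ef UV(1) by blast
    ultimately show ?thesis
      using card_mono[OF finV] v by metis
  qed
  have mint: "2 * int (card E) = int (r + c) * (int (r + c) - 1) - int c * (int c - 1)"
  proof -
    have "c choose 2 \<le> (r + c) choose 2"
      by (rule binomial_right_mono) simp
    then show ?thesis
      using m twice_choose_two[of "r + c"] twice_choose_two[of c] by (simp add: of_nat_diff)
  qed
  show ?thesis
  proof (cases "V - U = {}")
    case True
    then have "U = V" "c = 0"
      using UV(2) by (auto simp: c_def)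
    have "card (V - e) = r - 2"
      using ef(1) E(2) UV(1) v \<open>c = 0\<close> by (subst card_Diff_subset) auto
    then have "(r - 2) choose 2 \<le> s"
      using deg[OF ef(1)] \<open>U = V\<close> by (simp add: binomial_eq_0)
    then have s_ge: "(int r - 2) * (int r - 3) \<le> 2 * int s"
      using twice_choose_two[of "r - 2"] r2 by (simp add: of_nat_diff)
    have m': "2 * int (card E) = int r * (int r - 1)"
      using mint \<open>c = 0\<close> by simp
    have "(int r - 3) * (int r - 6) \<le> 0"
      using s_ge m' big by (simp add: algebra_simps)
    moreover have "r \<ge> 4"
      using v4 \<open>c = 0\<close> by simp
    ultimately have "r \<le> 6"
      by (simp add: mult_le_0_iff)
    \<comment> \<open>For each value of \<open>r\<close>, \<open>s_ge\<close> bounds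
      \<open>s\<close> from below and \<open>big\<close> bounds it from above, and the two bounds
      coincide.\<close>
    then consider "r = 4" | "r = 5" | "r = 6"
      using \<open>r \<ge> 4\<close> by linarith
    then have "r = 4 \<and> s = 1 \<or> r = 5 \<and> s = 3 \<or> r = 6 \<and> s = 6"
    proof cases
      case 1
      then show ?thesis
        using s_ge m' big by simp
    next
      case 2
      then show ?thesis
        using s_ge m' big by simp
    next
      case 3
      then show ?thesis
        using s_ge m' big by simp
    qed
    then have sizes: "card V = 4 \<and> s = 1 \<or> card V = 5 \<and> s = 3 \<or> card V = 6 \<and> s = 6"
      using v \<open>c = 0\<close> by simp
    have EV: "E = [V]\<^bsup>2\<^esup>"
      using UV(3) unfolding \<open>U = V\<close> nsets_2_meeting_self .
    show ?thesis
      by (rule complete[OF finV VE EV sizes])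
  next
    case False
    then have "c \<noteq> 0"
      using finV by (simp add: c_def)
    then have c2: "2 \<le> c"
      using UV(4) by (simp add: c_def)
    obtain z where z: "z \<in> V - U"
      using False by blast
    \<comment> \<open>An edge with one end outside \<open>U\<close> is disjoint from at least as
      many edges as one inside \<open>U\<close>, so it gives the stronger bound.\<close>
    have xz: "{x, z} \<in> E"
      using xy z UV(2) by (subst UV(3)) auto
    have "x \<noteq> z"
      using xy z by blast
    then have "card (V - {x, z}) = r + c - 2"
      using xy z UV(2) v by (subst card_Diff_subset) auto
    moreover have "V - U - {x, z} = V - U - {z}"
      using xy by auto
    then have "card (V - U - {x, z}) = c - 1"
      using z finV by (simp add: c_def)
    ultimately have "((r + c - 2) choose 2) - ((c - 1) choose 2) \<le> s"
      using deg[OF xz] by simp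
    moreover have "(c - 1) choose 2 \<le> (r + c - 2) choose 2"
      using r2 by (intro binomial_right_mono) simp
    ultimately have s_ge: "(int r + int c - 2) * (int r + int c - 3) - (int c - 1) * (int c - 2) \<le> 2 * int s"
      using twice_choose_two[of "r + c - 2"] twice_choose_two[of "c - 1"] r2 c2
      by (simp add: of_nat_diff algebra_simps)
    have quad: "(int r - 2) * (int r + 2 * int c - 7) \<le> 0"
      using s_ge mint big by (simp add: algebra_simps)
    show ?thesis
    proof (cases "r = 2")
      case True
      then have "int c - 1 \<le> int s" "int (card E) = 2 * int c + 1"
        using s_ge mint by (simp_all add: algebra_simps)
      then have "c = s + 1" "card E = 2 * s + 3"
        using big by linarith+
      moreover from this have "s \<noteq> 1" "s \<noteq> 3"
        using big1 big3 by auto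
      ultimately show ?thesis
        using double_star[OF finV VE UV(2,3)] True v by (simp add: r_def)
    next
      case False
      then have "0 < int r - 2"
        using r2 by simp
      then have "int r + 2 * int c - 7 \<le> 0"
        using quad by (simp add: mult_le_0_iff)
      \<comment> \<open>This is the complete graph on five vertices minus an edge. It forces
        \<open>s = 3\<close> but has only nine edges, against \<open>big3\<close>.\<close>
      then have "r = 3" "c = 2"
        using c2 \<open>0 < int r - 2\<close> by linarith+
      then show ?thesis
        using s_ge mint big big3 by simp
    qed
  qed
qed

section \<open>Graphs supplying the lower bounds\<close>

lemma complete_graph_almost_intersecting:
  assumes "finite V"
  shows "almost_t_intersecting ((card V - 2) choose 2) 1 ([V]\<^bsup>2\<^esup>)" "card ([V]\<^bsup>2\<^esup>) = card V choose 2"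
proof -
  show "card ([V]\<^bsup>2\<^esup>) = card V choose 2"
    using card_nsets_diff[OF assms, of 2 V "{}"] by (simp add: binomial_eq_0 nsets_2_meeting_self)
  show "almost_t_intersecting ((card V - 2) choose 2) 1 ([V]\<^bsup>2\<^esup>)"
    unfolding almost_t_intersecting_def
  proof
    fix e assume e: "e \<in> [V]\<^bsup>2\<^esup>"
    have "{f \<in> [V]\<^bsup>2\<^esup>. card (f \<inter> e) < 1} = {f \<in> [V]\<^bsup>2\<^esup>. f \<inter> e = {}}"
      by (auto simp: nsets_def)
    also have "\<dots> = {f \<in> [V]\<^bsup>2\<^esup>. f \<inter> V \<noteq> {} \<and> f \<inter> e = {}}"
      using nsets_2_meeting_self[of V] by blast
    finally have "card {f \<in> [V]\<^bsup>2\<^esup>. card (f \<inter> e) < 1} = card (V - e) choose 2"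
      using card_nsets_diff[OF assms, of 2 V e] by (simp add: binomial_eq_0)
    moreover have "card (V - e) = card V - 2"
      using e by (auto simp: nsets_def card_Diff_subset)
    ultimately show "card {f \<in> [V]\<^bsup>2\<^esup>. card (f \<inter> e) < 1} \<le> (card V - 2) choose 2"
      by simp
  qed
qed

text \<open>Deleting an edge \<open>e\<close> leaves \<open>s + 1\<close> vertices, at least
  \<open>s\<close> of them outside \<open>U\<close>. The edges disjoint from \<open>e\<close> thus
  number at most \<open>(s + 1 choose 2) - (s choose 2) = s\<close>. This graph underlies families
  (vi) and (vii).\<close>

lemma double_star_almost_intersecting:
  assumes V: "finite V" "U \<subseteq> V" "card U = 2" "card V = s + 3"
  defines "E \<equiv> {e \<in> [V]\<^bsup>2\<^esup>. e \<inter> U \<noteq> {}}"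
  shows "almost_t_intersecting s 1 E" "card E = 2 * s + 3"
proof -
  have finU: "finite U"
    using V finite_subset by blast
  have VU: "card (V - U) = s + 1"
    using V finU by (simp add: card_Diff_subset)
  have "int (card E) = int ((s + 3) choose 2) - int ((s + 1) choose 2)"
    using card_nsets_diff[OF V(1), of 2 U "{}"] VU V(4) binomial_right_mono[of "s + 1" "s + 3" 2]
    by (simp add: E_def of_nat_diff)
  then have "2 * int (card E) = 2 * int (2 * s + 3)"
    using twice_choose_two[of "s + 3"] twice_choose_two[of "s + 1"] by (simp add: algebra_simps)
  then show "card E = 2 * s + 3"
    by (simp only: mult_cancel_left of_nat_eq_iff) simp
  show "almost_t_intersecting s 1 E"
    unfolding almost_t_intersecting_def
  proof
    fix e assume e: "e \<in> E"
    have fin: "finite e" "card e = 2" "e \<subseteq> V" "e \<inter> U \<noteq> {}"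
      using e by (auto simp: E_def nsets_def)
    have "{f \<in> E. card (f \<inter> e) < 1} = {f \<in> [V]\<^bsup>2\<^esup>. f \<inter> U \<noteq> {} \<and> f \<inter> e = {}}"
      using fin(1) by (auto simp: E_def)
    moreover have "card (V - e) = s + 1"
      using fin V by (simp add: card_Diff_subset)
    moreover have "s \<le> card (V - U - e)"
    proof -
      have "card (e - U) < card e"
        using fin by (intro psubset_card_mono) auto
      then have "card (e - U) \<le> 1"
        using fin by simp
      moreover have "card (V - U) - card (e - U) \<le> card (V - U - (e - U))"
        using fin by (intro diff_card_le_card_Diff) auto
      moreover have "V - U - (e - U) = V - U - e"
        by blast
      ultimately show ?thesis
        using VU by simp
    qed
    then have "s choose 2 \<le> card (V - U - e) choose 2"
      by (rule binomial_right_mono)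
    moreover have "(s + 1) choose 2 = (s choose 2) + s"
      by (simp add: numeral_2_eq_2)
    ultimately show "card {f \<in> E. card (f \<inter> e) < 1} \<le> s"
      using card_nsets_diff[OF V(1), of 2 U e] by simp
  qed
qed

section \<open>Relabelling chains of sets as initial segments\<close>

lemma bij_betw_extend:
  assumes "finite B" "A \<subseteq> B" "A' \<subseteq> B'" "bij_betw f A A'" "finite B'" "card B = card B'"
  obtains g where "bij_betw g B B'" "\<And>x. x \<in> A \<Longrightarrow> g x = f x"
proof -
  have "card (B - A) = card (B' - A')"
    using assms by (metis bij_betw_same_card card_Diff_subset finite_subset)
  then obtain h where h: "bij_betw h (B - A) (B' - A')"
    using assms by (meson finite_Diff finite_same_card_bij)
  define g where "g x = (if x \<in> A then f x else h x)" for x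
  have "bij_betw g A A'"
    using assms(4) by (subst bij_betw_cong[of A g f]) (auto simp: g_def)
  moreover have "bij_betw g (B - A) (B' - A')"
    using h by (subst bij_betw_cong[of "B - A" g h]) (auto simp: g_def)
  ultimately have "bij_betw g (A \<union> (B - A)) (A' \<union> (B' - A'))"
    by (rule bij_betw_combine) auto
  then show ?thesis
    using that[of g] assms(2,3) by (simp add: g_def Un_absorb1)
qed

text \<open>The bijection is extended step by step along \<open>A\<close>, \<open>B\<close>,
  \<open>C\<close> and the whole ground set, each time agreeing with the previous one.\<close>

lemma permutes_onto_initial_segments:
  assumes "A \<subseteq> B" "B \<subseteq> C" "C \<subseteq> {1..n::nat}"
  obtains \<pi> where "\<pi> permutes {1..n}" "\<pi> ` A = {1..card A}" "\<pi> ` B = {1..card B}" "\<pi> ` C = {1..card C}"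
proof -
  have fin: "finite A" "finite B" "finite C"
    using assms by (meson finite_atLeastAtMost finite_subset)+
  have le: "card A \<le> card B" "card B \<le> card C" "card C \<le> n"
    using assms fin card_mono[of "{1..n}" C] by (auto simp: card_mono)
  obtain f where f: "bij_betw f A {1..card A}"
    using fin by (metis card_atLeastAtMost diff_Suc_1 finite_atLeastAtMost finite_same_card_bij)
  obtain g where g: "bij_betw g B {1..card B}" "\<And>x. x \<in> A \<Longrightarrow> g x = f x"
    using bij_betw_extend[OF fin(2) assms(1) _ f, of "{1..card B}"] le by auto
  obtain h where h: "bij_betw h C {1..card C}" "\<And>x. x \<in> B \<Longrightarrow> h x = g x"
    using bij_betw_extend[OF fin(3) assms(2) _ g(1), of "{1..card C}"] le by auto
  obtain k where k: "bij_betw k {1..n} {1..n}" "\<And>x. x \<in> C \<Longrightarrow> k x = h x"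
    using bij_betw_extend[OF _ assms(3) _ h(1), of "{1..n}"] le by auto
  define \<pi> where "\<pi> x = (if x \<in> {1..n} then k x else x)" for x
  have \<pi>: "\<pi> x = k x" if "x \<in> C" for x
    using that assms by (auto simp: \<pi>_def)
  have "bij_betw \<pi> {1..n} {1..n}"
    using k(1) by (subst bij_betw_cong[of "{1..n}" \<pi> k]) (auto simp: \<pi>_def)
  then have "\<pi> permutes {1..n}"
    by (rule bij_imp_permutes) (auto simp: \<pi>_def)
  moreover have "\<pi> ` C = h ` C" "\<pi> ` B = g ` B" "\<pi> ` A = f ` A"
    using assms \<pi> k(2) h(2) g(2) by (auto intro!: image_cong simp: subset_iff)
  ultimately show ?thesis
    using that f g(1) h(1) by (simp add: bij_betw_imp_surj_on)
qed

text \<open>One statement serves all seven target families: \<open>A\<close> is the forced core,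
  \<open>C\<close> the ground set and \<open>B\<close> the set to be met in at least
  \<open>j\<close> elements. For \<open>j = 0\<close> the last condition is vacuous.\<close>

lemma family_iso_initial_segments:
  assumes "A \<subseteq> B" "B \<subseteq> C" "C \<subseteq> {1..n}"
  shows "family_iso n {F \<in> [C]\<^bsup>k\<^esup>. A \<subseteq> F \<and> j \<le> card (F \<inter> B)}
           {F \<in> [{1..card C}]\<^bsup>k\<^esup>. {1..card A} \<subseteq> F \<and> j \<le> card (F \<inter> {1..card B})}"
proof -
  obtain \<pi> where \<pi>: "\<pi> permutes {1..n}" "\<pi> ` A = {1..card A}" "\<pi> ` B = {1..card B}" "\<pi> ` C = {1..card C}"
    using permutes_onto_initial_segments[OF assms] by blast
  have inj: "inj \<pi>"
    using \<pi>(1) by (rule permutes_inj)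
  define L where "L = {F \<in> [C]\<^bsup>k\<^esup>. A \<subseteq> F \<and> j \<le> card (F \<inter> B)}"
  define R where "R = {F \<in> [{1..card C}]\<^bsup>k\<^esup>. {1..card A} \<subseteq> F \<and> j \<le> card (F \<inter> {1..card B})}"
  have card_image_\<pi>: "card (\<pi> ` X) = card X" for X
    using inj by (meson card_image inj_on_subset subset_UNIV)
  have finite_image_\<pi>: "finite (\<pi> ` X) \<longleftrightarrow> finite X" for X
    using inj by (meson finite_image_iff inj_on_subset subset_UNIV)
  have iff: "\<pi> ` F \<in> R \<longleftrightarrow> F \<in> L" for F
    unfolding L_def R_def \<pi>(2,3,4)[symmetric] nsets_def mem_Collect_eq image_Int[OF inj, symmetric]
      card_image_\<pi> finite_image_\<pi> inj_image_subset_iff[OF inj] ..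
  have "(\<lambda>F. \<pi> ` F) ` L = R"
  proof (intro equalityI subsetI)
    fix G assume "G \<in> R"
    moreover have G: "\<pi> ` (\<pi> -` G) = G"
      using permutes_surj[OF \<pi>(1)] by (simp add: surj_image_vimage_eq)
    ultimately have "\<pi> -` G \<in> L"
      using iff[of "\<pi> -` G"] by simp
    then show "G \<in> (\<lambda>F. \<pi> ` F) ` L"
      using G by (intro image_eqI[of _ _ "\<pi> -` G"]) simp_all
  qed (use iff in blast)
  then show ?thesis
    using \<pi>(1) unfolding family_iso_def L_def R_def by blast
qed

lemma family_iso_two_initial_segments:
  assumes "A \<subseteq> C" "C \<subseteq> {1..n}"
  shows "family_iso n {F \<in> [C]\<^bsup>k\<^esup>. A \<subseteq> F} {F \<in> [{1..card C}]\<^bsup>k\<^esup>. {1..card A} \<subseteq> F}"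
  using family_iso_initial_segments[OF order_refl assms, where j = 0] by simp

section \<open>Passing between set families and graphs\<close>

text \<open>Both intersection notions depend only on which pairs are far. An injective
  \<open>T\<close> that turns disjointness into farness therefore preserves them; it is kept
  abstract to cover both adding \<open>Z\<close> and complementing in \<open>Y\<close>.\<close>

lemma graph_transfer:
  assumes inj: "inj_on T E" and E: "E \<subseteq> [X]\<^bsup>2\<^esup>"
    and T: "\<And>e f. e \<in> E \<Longrightarrow> f \<in> E \<Longrightarrow> card (T e \<inter> T f) < t \<longleftrightarrow> e \<inter> f = {}"
  shows "almost_t_intersecting s t (T ` E) \<longleftrightarrow> (\<forall>e\<in>E. card {f \<in> E. f \<inter> e = {}} \<le> s)"
    and "t_intersecting t (T ` E) \<longleftrightarrow> (\<forall>e\<in>E. \<forall>f\<in>E. e \<inter> f \<noteq> {})"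
    and "almost_t_intersecting s t (T ` E) \<longleftrightarrow> almost_t_intersecting s 1 E"
    and "t_intersecting t (T ` E) \<longleftrightarrow> t_intersecting 1 E"
proof -
  have fin: "card (e \<inter> f) < 1 \<longleftrightarrow> e \<inter> f = {}" if "e \<in> E" for e f
  proof -
    have "finite (e \<inter> f)"
      using that E by (auto simp: nsets_def)
    then show ?thesis
      by simp
  qed
  have "card {F \<in> T ` E. card (F \<inter> T e) < t} = card {f \<in> E. f \<inter> e = {}}" if "e \<in> E" for e
  proof -
    have "{F \<in> T ` E. card (F \<inter> T e) < t} = T ` {f \<in> E. f \<inter> e = {}}"
      using T that by auto
    then show ?thesis
      using inj by (metis (no_types, lifting) card_image inj_on_subset mem_Collect_eq subsetI)
  qed
  then show 1: "almost_t_intersecting s t (T ` E) \<longleftrightarrow> (\<forall>e\<in>E. card {f \<in> E. f \<inter> e = {}} \<le> s)"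
    unfolding almost_t_intersecting_def by simp
  show 2: "t_intersecting t (T ` E) \<longleftrightarrow> (\<forall>e\<in>E. \<forall>f\<in>E. e \<inter> f \<noteq> {})"
    unfolding t_intersecting_def using T by (auto simp: linorder_not_less[symmetric])
  have "{f \<in> E. card (f \<inter> e) < 1} = {f \<in> E. f \<inter> e = {}}" for e
    using fin by auto
  then show "almost_t_intersecting s t (T ` E) \<longleftrightarrow> almost_t_intersecting s 1 E"
    unfolding 1 by (simp add: almost_t_intersecting_def)
  show "t_intersecting t (T ` E) \<longleftrightarrow> t_intersecting 1 E"
    unfolding 2 unfolding t_intersecting_def using fin by (simp add: linorder_not_less[symmetric])
qed

lemma sunflower_transfer:
  assumes Z: "finite Z" "card Z + 1 = t" and E: "E \<subseteq> [X]\<^bsup>2\<^esup>" "X \<inter> Z = {}"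
  shows "inj_on ((\<union>) Z) E"
    and "\<And>e f. e \<in> E \<Longrightarrow> f \<in> E \<Longrightarrow> card ((Z \<union> e) \<inter> (Z \<union> f)) < t \<longleftrightarrow> e \<inter> f = {}"
proof -
  have e: "finite e" "e \<inter> Z = {}" if "e \<in> E" for e
    using that E by (auto simp: nsets_def)
  show "inj_on ((\<union>) Z) E"
    using e(2) by (intro inj_onI) blast
  fix e f assume ef: "e \<in> E" "f \<in> E"
  have "(Z \<union> e) \<inter> (Z \<union> f) = Z \<union> (e \<inter> f)"
    by blast
  moreover have "card (Z \<union> (e \<inter> f)) = card Z + card (e \<inter> f)"
    using e[OF ef(1)] Z by (intro card_Un_disjoint) auto
  ultimately have "card ((Z \<union> e) \<inter> (Z \<union> f)) = card Z + card (e \<inter> f)"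
    by simp
  then have "card ((Z \<union> e) \<inter> (Z \<union> f)) < t \<longleftrightarrow> card (e \<inter> f) = 0"
    using Z by linarith
  then show "card ((Z \<union> e) \<inter> (Z \<union> f)) < t \<longleftrightarrow> e \<inter> f = {}"
    using e[OF ef(1)] by simp
qed

text \<open>Since \<open>card (e \<union> f) = 4 - card (e \<inter> f)\<close>, the complements meet
  in \<open>t - 1 + card (e \<inter> f)\<close> elements, exactly as in the sunflower case.\<close>

lemma dual_transfer:
  assumes Y: "finite Y" "card Y = t + 3" and E: "E \<subseteq> [Y]\<^bsup>2\<^esup>" and t: "0 < t"
  shows "inj_on ((-) Y) E"
    and "\<And>e f. e \<in> E \<Longrightarrow> f \<in> E \<Longrightarrow> card ((Y - e) \<inter> (Y - f)) < t \<longleftrightarrow> e \<inter> f = {}"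
proof -
  have e: "finite e" "e \<subseteq> Y" "card e = 2" if "e \<in> E" for e
    using that E by (auto simp: nsets_def)
  show "inj_on ((-) Y) E"
    using e(2) by (intro inj_onI) (metis double_diff order_refl)
  fix e f assume ef: "e \<in> E" "f \<in> E"
  have "(Y - e) \<inter> (Y - f) = Y - (e \<union> f)"
    by blast
  moreover have "card (Y - (e \<union> f)) = t + 3 - card (e \<union> f)"
    using e[OF ef(1)] e[OF ef(2)] Y by (subst card_Diff_subset) auto
  moreover have "card (e \<union> f) + card (e \<inter> f) = 4"
    using card_Un_Int[of e f] e[OF ef(1)] e[OF ef(2)] by simp
  \<comment> \<open>Keeps \<open>t + 3 - card (e \<union> f)\<close> from truncating.\<close>
  moreover have "card (e \<union> f) \<le> t + 3"
    using card_mono[OF Y(1), of "e \<union> f"] Y(2) e[OF ef(1)] e[OF ef(2)] by simp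
  ultimately have "card ((Y - e) \<inter> (Y - f)) < t \<longleftrightarrow> card (e \<inter> f) = 0"
    by auto
  then show "card ((Y - e) \<inter> (Y - f)) < t \<longleftrightarrow> e \<inter> f = {}"
    using e[OF ef(1)] by simp
qed

text \<open>For \<open>F = Z \<union> e\<close> one has \<open>card (F \<inter> (Z \<union> U)) = t
  - 1 + card (e \<inter> U)\<close>, so meeting \<open>U\<close> becomes the threshold
  \<open>t\<close>.\<close>

lemma sunflower_image:
  assumes Z: "finite Z" "card Z + 1 = t" and V: "finite V" "V \<inter> Z = {}" "U \<subseteq> V"
  shows "(\<union>) Z ` {e \<in> [V]\<^bsup>2\<^esup>. e \<inter> U \<noteq> {}}
    = {F \<in> [Z \<union> V]\<^bsup>(t + 1)\<^esup>. Z \<subseteq> F \<and> t \<le> card (F \<inter> (Z \<union> U))}"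
proof (intro equalityI subsetI)
  have meet: "t \<le> card ((Z \<union> e) \<inter> (Z \<union> U)) \<longleftrightarrow> e \<inter> U \<noteq> {}" if "e \<subseteq> V" for e
  proof -
    have "(Z \<union> e) \<inter> (Z \<union> U) = Z \<union> (e \<inter> U)"
      using V that by blast
    moreover have "finite (e \<inter> U)"
      using that V by (auto intro: finite_subset)
    moreover have "Z \<inter> (e \<inter> U) = {}"
      using that V by blast
    ultimately have "card ((Z \<union> e) \<inter> (Z \<union> U)) = card Z + card (e \<inter> U)"
      using Z by (simp add: card_Un_disjoint)
    moreover have "card (e \<inter> U) = 0 \<longleftrightarrow> e \<inter> U = {}"
      using \<open>finite (e \<inter> U)\<close> by simp
    ultimately show ?thesis
      using Z by linarith
  qed
  {
    fix F assume "F \<in> (\<union>) Z ` {e \<in> [V]\<^bsup>2\<^esup>. e \<inter> U \<noteq> {}}"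
    then obtain e where e: "F = Z \<union> e" "e \<subseteq> V" "finite e" "card e = 2" "e \<inter> U \<noteq> {}"
      by (auto simp: nsets_def)
    moreover have "Z \<inter> e = {}"
      using e V by blast
    ultimately have "card F = t + 1"
      using Z by (simp add: card_Un_disjoint)
    then show "F \<in> {F \<in> [Z \<union> V]\<^bsup>(t + 1)\<^esup>. Z \<subseteq> F \<and> t \<le> card (F \<inter> (Z \<union> U))}"
      using e Z meet[OF e(2)] by (auto simp: nsets_def)
  next
    fix F assume F: "F \<in> {F \<in> [Z \<union> V]\<^bsup>(t + 1)\<^esup>. Z \<subseteq> F \<and> t \<le> card (F \<inter> (Z \<union> U))}"
    then have "F - Z \<subseteq> V" "finite F" "(Z \<union> (F - Z)) \<inter> (Z \<union> U) = F \<inter> (Z \<union> U)"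
      by (auto simp: nsets_def)
    moreover have "card (F - Z) = 2"
      using F Z by (auto simp: nsets_def card_Diff_subset)
    ultimately have "F - Z \<in> {e \<in> [V]\<^bsup>2\<^esup>. e \<inter> U \<noteq> {}}"
      using F meet[of "F - Z"] by (simp add: nsets_def)
    moreover have "F = Z \<union> (F - Z)"
      using F by blast
    ultimately show "F \<in> (\<union>) Z ` {e \<in> [V]\<^bsup>2\<^esup>. e \<inter> U \<noteq> {}}"
      by (rule image_eqI[rotated])
  }
qed

lemma sunflower_complete_image:
  assumes Z: "finite Z" "card Z + 1 = t" and V: "finite V" "V \<inter> Z = {}"
  shows "(\<union>) Z ` [V]\<^bsup>2\<^esup> = {F \<in> [Z \<union> V]\<^bsup>(t + 1)\<^esup>. Z \<subseteq> F}"
proof -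
  have "t \<le> card (F \<inter> (Z \<union> V))" if "F \<in> [Z \<union> V]\<^bsup>(t + 1)\<^esup>" for F
    using that by (auto simp: nsets_def Int_absorb2)
  then show ?thesis
    using sunflower_image[OF Z V order_refl] unfolding nsets_2_meeting_self by blast
qed

text \<open>Because \<open>card U = 2\<close>, the set \<open>Y - e\<close> meets
  \<open>Y - U\<close> in \<open>t - 1 + card (e \<inter> U)\<close> elements. Hence the same
  threshold \<open>t\<close> appears in families (vi) and (vii).\<close>

lemma dual_image:
  assumes Y: "finite Y" "card Y = t + 3" and V: "V \<subseteq> Y" "U \<subseteq> V" "card U = 2"
  shows "(-) Y ` {e \<in> [V]\<^bsup>2\<^esup>. e \<inter> U \<noteq> {}}
    = {F \<in> [Y]\<^bsup>(t + 1)\<^esup>. Y - V \<subseteq> F \<and> t \<le> card (F \<inter> (Y - U))}"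
proof (intro equalityI subsetI)
  have meet: "t \<le> card ((Y - e) \<inter> (Y - U)) \<longleftrightarrow> e \<inter> U \<noteq> {}" if "e \<subseteq> V" "card e = 2" for e
  proof -
    have fin: "finite e" "finite U" "e \<union> U \<subseteq> Y"
      using that V Y by (auto intro: finite_subset)
    have "(Y - e) \<inter> (Y - U) = Y - (e \<union> U)"
      by blast
    then have "card ((Y - e) \<inter> (Y - U)) = t + 3 - card (e \<union> U)"
      using fin Y by (simp add: card_Diff_subset)
    moreover have "card (e \<union> U) + card (e \<inter> U) = 4"
      using card_Un_Int[of e U] fin that V by simp
    moreover have "card (e \<inter> U) = 0 \<longleftrightarrow> e \<inter> U = {}"
      using fin by simp
    moreover have "card (e \<union> U) \<le> t + 3"
      using card_mono[OF Y(1) fin(3)] Y(2) by simp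
    ultimately show ?thesis
      by linarith
  qed
  {
    fix F assume "F \<in> (-) Y ` {e \<in> [V]\<^bsup>2\<^esup>. e \<inter> U \<noteq> {}}"
    then obtain e where e: "F = Y - e" "e \<subseteq> V" "finite e" "card e = 2" "e \<inter> U \<noteq> {}"
      by (auto simp: nsets_def)
    then have "card F = t + 1"
      using Y V by (simp add: card_Diff_subset)
    then show "F \<in> {F \<in> [Y]\<^bsup>(t + 1)\<^esup>. Y - V \<subseteq> F \<and> t \<le> card (F \<inter> (Y - U))}"
      using e Y meet[OF e(2,4)] by (auto simp: nsets_def)
  next
    fix F assume F: "F \<in> {F \<in> [Y]\<^bsup>(t + 1)\<^esup>. Y - V \<subseteq> F \<and> t \<le> card (F \<inter> (Y - U))}"
    then have "Y - F \<subseteq> V" "finite (Y - F)" "(Y - (Y - F)) \<inter> (Y - U) = F \<inter> (Y - U)"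
      using Y by (auto simp: nsets_def)
    moreover have "card (Y - F) = 2"
      using F Y by (auto simp: nsets_def card_Diff_subset)
    ultimately have "Y - F \<in> {e \<in> [V]\<^bsup>2\<^esup>. e \<inter> U \<noteq> {}}"
      using F meet[of "Y - F"] by (simp add: nsets_def)
    moreover have "F = Y - (Y - F)"
      using F by (auto simp: nsets_def)
    ultimately show "F \<in> (-) Y ` {e \<in> [V]\<^bsup>2\<^esup>. e \<inter> U \<noteq> {}}"
      by (rule image_eqI[rotated])
  }
qed

text \<open>Proved directly, since \<open>dual_image\<close> is tied to a \<open>U\<close> of size
  two and cannot be taken with \<open>U = V\<close>.\<close>

lemma dual_complete_image:
  assumes Y: "finite Y" "card Y = t + 3" and V: "V \<subseteq> Y"
  shows "(-) Y ` [V]\<^bsup>2\<^esup> = {F \<in> [Y]\<^bsup>(t + 1)\<^esup>. Y - V \<subseteq> F}"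
proof (intro equalityI subsetI)
  fix F assume "F \<in> (-) Y ` [V]\<^bsup>2\<^esup>"
  then show "F \<in> {F \<in> [Y]\<^bsup>(t + 1)\<^esup>. Y - V \<subseteq> F}"
    using Y V by (auto simp: nsets_def card_Diff_subset)
next
  fix F assume F: "F \<in> {F \<in> [Y]\<^bsup>(t + 1)\<^esup>. Y - V \<subseteq> F}"
  then have "Y - F \<subseteq> V" "card (Y - F) = 2"
    using Y by (auto simp: nsets_def card_Diff_subset)
  then have "Y - F \<in> [V]\<^bsup>2\<^esup>"
    using Y by (simp add: nsets_def)
  moreover have "F = Y - (Y - F)"
    using F by (auto simp: nsets_def)
  ultimately show "F \<in> (-) Y ` [V]\<^bsup>2\<^esup>"
    by (rule image_eqI[rotated])
qed

section \<open>Lower bounds from maximality and assembly of the cases\<close>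

theorem theorem1p5:
  fixes n t s :: nat and \<F> :: "nat set set"
  assumes "n > 0" and "t > 0" and "s > 0"
    and "n \<ge> t + s + 2"
    and "\<F> \<subseteq> [{1..n}]\<^bsup>(t + 1)\<^esup>"
    and "almost_t_intersecting s t \<F>"
    and "\<not> t_intersecting t \<F>"
    and "\<And>\<G>. \<G> \<subseteq> [{1..n}]\<^bsup>(t + 1)\<^esup> \<Longrightarrow> almost_t_intersecting s t \<G> \<Longrightarrow> \<not> t_intersecting t \<G>
           \<Longrightarrow> card \<G> \<le> card \<F>"
  shows
    "(s = 1 \<and> family_iso n \<F> {F \<in> [{1..t+3}]\<^bsup>(t + 1)\<^esup>. {1..t-1} \<subseteq> F}) \<or>
     (s = 3 \<and> family_iso n \<F> {F \<in> [{1..t+4}]\<^bsup>(t + 1)\<^esup>. {1..t-1} \<subseteq> F}) \<or>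
     (s = 3 \<and> t \<ge> 2 \<and> family_iso n \<F> {F \<in> [{1..t+3}]\<^bsup>(t + 1)\<^esup>. {1..t-2} \<subseteq> F}) \<or>
     (s = 6 \<and> family_iso n \<F> {F \<in> [{1..t+5}]\<^bsup>(t + 1)\<^esup>. {1..t-1} \<subseteq> F}) \<or>
     (s = 6 \<and> t \<ge> 3 \<and> family_iso n \<F> {F \<in> [{1..t+3}]\<^bsup>(t + 1)\<^esup>. {1..t-3} \<subseteq> F}) \<or>
     (s \<noteq> 1 \<and> s \<noteq> 3 \<and> family_iso n \<F>
        {F \<in> [{1..t+s+2}]\<^bsup>(t + 1)\<^esup>. {1..t-1} \<subseteq> F \<and> card (F \<inter> {1..t+1}) \<ge> t}) \<or>
     (s \<noteq> 1 \<and> s \<noteq> 3 \<and> t \<ge> s \<and> family_iso n \<F>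
        {F \<in> [{1..t+3}]\<^bsup>(t + 1)\<^esup>. {1..t-s} \<subseteq> F \<and> card (F \<inter> {1..t+1}) \<ge> t})"
proof -
  have fin: "finite \<F>"
    using assms(5) by (rule finite_subset) (simp add: finite_imp_finite_nsets)
  have uniform: "\<forall>F\<in>\<F>. finite F \<and> card F = t + 1"
    using assms(5) by (auto simp: nsets_def)
  have lower: "card E \<le> card \<F>"
    \<comment> \<open>Adding the core \<open>{1..t-1}\<close> to each edge makes any such graph a
      competitor of \<open>\<F>\<close>.\<close>
    if E: "E \<subseteq> [{t..n}]\<^bsup>2\<^esup>" "almost_t_intersecting s 1 E" "\<not> t_intersecting 1 E" for E
  proof -
    have Z: "finite {1..t-1}" "card {1..t-1} + 1 = t"
      using assms(2) by auto
    have X: "{t..n} \<inter> {1..t-1} = {}"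
      using assms(2) by auto
    note tr = sunflower_transfer[OF Z E(1) X]
    let ?G = "(\<union>) {1..t-1} ` E"
    have "?G \<subseteq> [{1..n}]\<^bsup>(t + 1)\<^esup>"
    proof
      fix G assume "G \<in> ?G"
      then obtain e where e: "G = {1..t-1} \<union> e" "e \<subseteq> {t..n}" "finite e" "card e = 2"
        using E(1) by (auto simp: nsets_def)
      moreover have "{1..t-1} \<inter> e = {}"
        using e(2) X by blast
      ultimately have "card G = t + 1"
        using Z by (simp add: card_Un_disjoint)
      moreover have "{1..t-1} \<union> e \<subseteq> {1..n}"
        using e(2) assms(2,4) by (auto simp: subset_iff)
      ultimately show "G \<in> [{1..n}]\<^bsup>(t + 1)\<^esup>"
        using e by (simp add: nsets_def)
    qed
    then have "card ?G \<le> card \<F>"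
      using E(2,3) graph_transfer(3,4)[OF tr(1) E(1) tr(2)] assms(8) by blast
    then show ?thesis
      using tr(1) by (simp add: card_image)
  qed
  \<comment> \<open>Both edges meet \<open>{t, t + 1}\<close>, so this pair serves the double star
    as well as the complete graphs.\<close>
  have disjoint: "\<not> t_intersecting 1 E" if "{t, t + 2} \<in> E" "{t + 1, t + 3} \<in> E" for E :: "nat set set"
  proof
    assume "t_intersecting 1 E"
    then have "1 \<le> card ({t, t + 2} \<inter> {t + 1, t + 3})"
      using that unfolding t_intersecting_def by blast
    then show False
      by simp
  qed
  have big: "2 * s + 3 \<le> card \<F>"
  proof -
    let ?E = "{e \<in> [{t..t+s+2}]\<^bsup>2\<^esup>. e \<inter> {t, t+1} \<noteq> {}}"
    have "almost_t_intersecting s 1 ?E" "card ?E = 2 * s + 3"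
      by (rule double_star_almost_intersecting; simp)+
    moreover have "?E \<subseteq> [{t..n}]\<^bsup>2\<^esup>"
      using assms(4) nsets_mono[of "{t..t+s+2}" "{t..n}" 2] by auto
    moreover have "\<not> t_intersecting 1 ?E"
      using assms(3) by (intro disjoint) auto
    ultimately show ?thesis
      using lower[of ?E] by simp
  qed
  \<comment> \<open>In the complete graph on \<open>k + 4\<close> vertices each edge is disjoint
    from \<open>(k + 2) choose 2\<close> others. The condition \<open>k + 1 \<le> s\<close> makes
    the vertices fit below \<open>n\<close>.\<close>
  have big_complete: "(k + 4) choose 2 \<le> card \<F>" if "s = (k + 2) choose 2" "k + 1 \<le> s" for k
  proof -
    let ?E = "[{t..t+k+3}]\<^bsup>2\<^esup>"
    have c: "card {t..t+k+3} = k + 4"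
      by simp
    have "almost_t_intersecting s 1 ?E" "card ?E = (k + 4) choose 2"
      using complete_graph_almost_intersecting[of "{t..t+k+3}", unfolded c] that by simp_all
    moreover have "?E \<subseteq> [{t..n}]\<^bsup>2\<^esup>"
      using assms(4) that by (intro nsets_mono) auto
    moreover have "\<not> t_intersecting 1 ?E"
      by (intro disjoint) auto
    ultimately show ?thesis
      using lower[of ?E] by simp
  qed
  \<comment> \<open>For \<open>s = 1\<close> and \<open>s = 3\<close> the complete graphs on four
    and five vertices beat \<open>2 * s + 3\<close> by one; for \<open>s = 6\<close> six vertices
    only tie with it.\<close>
  have big1: "6 \<le> card \<F>" if "s = 1"
    using big_complete[of 0] that by (simp add: choose_two)
  have big3: "10 \<le> card \<F>" if "s = 3"
    using big_complete[of 1] that by (simp add: choose_two)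
  obtain A B where AB: "A \<in> \<F>" "B \<in> \<F>" "card (A \<inter> B) < t"
    using assms(7) unfolding t_intersecting_def by (meson not_le)
  have AB_n: "A \<subseteq> {1..n}" "B \<subseteq> {1..n}"
    using AB assms(5) by (auto simp: nsets_def)
  have finAB: "finite A" "finite B" "card A = t + 1" "card B = t + 1"
    using AB uniform by auto
  have AB1: "card (A \<inter> B) + 1 = t"
    by (rule octahedron(1)[OF fin uniform assms(6) big AB])
  \<comment> \<open>An elimination rule in \<open>T\<close>, to be used once with the union by
    \<open>Z\<close> and once with the complement in \<open>Y\<close>.\<close>
  have cls: thesis
    if T: "inj_on T E" "E \<subseteq> [X]\<^bsup>2\<^esup>" "\<F> = T ` E"
      "\<And>e f. e \<in> E \<Longrightarrow> f \<in> E \<Longrightarrow> card (T e \<inter> T f) < t \<longleftrightarrow> e \<inter> f = {}"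
    and complete: "\<And>V. finite V \<Longrightarrow> V \<subseteq> X \<Longrightarrow> \<F> = T ` [V]\<^bsup>2\<^esup> \<Longrightarrow>
      card V = 4 \<and> s = 1 \<or> card V = 5 \<and> s = 3 \<or> card V = 6 \<and> s = 6 \<Longrightarrow> thesis"
    and double_star: "\<And>U V. finite V \<Longrightarrow> V \<subseteq> X \<Longrightarrow> U \<subseteq> V \<Longrightarrow>
      \<F> = T ` {e \<in> [V]\<^bsup>2\<^esup>. e \<inter> U \<noteq> {}} \<Longrightarrow>
      card U = 2 \<Longrightarrow> card V = s + 3 \<Longrightarrow> s \<noteq> 1 \<Longrightarrow> s \<noteq> 3 \<Longrightarrow> thesis"
    for T E X and thesis :: bool
  proof -
    have E: "finite E" "\<forall>e\<in>E. finite e \<and> card e = 1 + 1"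
      using T(1-3) fin by (auto simp: nsets_def finite_image_iff)
    have X: "\<Union>E \<subseteq> X"
      using T(2) by (auto simp: nsets_def)
    have card: "card E = card \<F>"
      using T(1,3) by (simp add: card_image)
    have graph: "almost_t_intersecting s 1 E" "\<not> t_intersecting 1 E" "2 * s + 3 \<le> card E"
      using assms(6,7) graph_transfer(3,4)[OF T(1,2,4)] T(3) card big by auto
    show thesis
    proof (cases rule: graph_classification[OF E graph])
      case (3 V)
      then show thesis
        using complete[of V] X T(3) by auto
    next
      case (4 U V)
      then show thesis
        using double_star[of V U] X T(3) by auto
    qed (use big1 big3 card in simp_all)
  qed
  show ?thesis
    using sunflower_or_dual[OF fin uniform assms(6) big AB]
  proof
    assume all: "\<forall>G\<in>\<F>. A \<inter> B \<subseteq> G"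
    define Z where "Z = A \<inter> B"
    have Z: "finite Z" "card Z + 1 = t" "Z \<subseteq> {1..n}"
      using finAB AB1 AB_n by (auto simp: Z_def)
    define E where "E = (\<lambda>G. G - Z) ` \<F>"
    have E: "E \<subseteq> [{1..n} - Z]\<^bsup>2\<^esup>"
    proof
      fix e assume "e \<in> E"
      then obtain G where G: "e = G - Z" "G \<in> \<F>" by (auto simp: E_def)
      then have "Z \<subseteq> G" "G \<subseteq> {1..n}" "finite G" "card G = t + 1"
        using all assms(5) uniform by (auto simp: Z_def nsets_def)
      then show "e \<in> [{1..n} - Z]\<^bsup>2\<^esup>"
        using G Z by (auto simp: nsets_def card_Diff_subset)
    qed
    have "Z \<union> (G - Z) = G" if "G \<in> \<F>" for G
      using all that by (auto simp: Z_def)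
    then have F: "\<F> = (\<union>) Z ` E"
      by (simp add: E_def image_image)
    have "({1..n} - Z) \<inter> Z = {}"
      by blast
    note tr = sunflower_transfer[OF Z(1,2) E this]
    show ?thesis
    proof (rule cls[OF tr(1) E F tr(2)])
      fix V assume V: "finite V" "V \<subseteq> {1..n} - Z" "\<F> = (\<union>) Z ` [V]\<^bsup>2\<^esup>"
        and cases: "card V = 4 \<and> s = 1 \<or> card V = 5 \<and> s = 3 \<or> card V = 6 \<and> s = 6"
      have "V \<inter> Z = {}"
        using V(2) by blast
      have F_eq: "\<F> = {F \<in> [Z \<union> V]\<^bsup>(t + 1)\<^esup>. Z \<subseteq> F}"
        unfolding V(3) by (rule sunflower_complete_image[OF Z(1,2) V(1) \<open>V \<inter> Z = {}\<close>])
      have "card Z = t - 1"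
        using Z(2) by simp
      moreover from this have "card (Z \<union> V) = t - 1 + card V"
        using V(1) Z(1) \<open>V \<inter> Z = {}\<close> by (subst card_Un_disjoint) auto
      moreover have "Z \<union> V \<subseteq> {1..n}"
        using V(2) Z(3) by blast
      ultimately have iso: "family_iso n \<F> {F \<in> [{1..t - 1 + card V}]\<^bsup>(t + 1)\<^esup>. {1..t - 1} \<subseteq> F}"
        unfolding F_eq using family_iso_two_initial_segments[of Z "Z \<union> V" n "t + 1"] by simp
      from cases show ?thesis
      proof (elim disjE conjE)
        assume "card V = 4" "s = 1"
        then have "t - 1 + card V = t + 3"
          using assms(2) by simp
        note iso[unfolded this]
        then show ?thesis
          using \<open>s = 1\<close> by simp
      next
        assume "card V = 5" "s = 3"
        then have "t - 1 + card V = t + 4"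
          using assms(2) by simp
        note iso[unfolded this]
        then show ?thesis
          using \<open>s = 3\<close> by simp
      next
        assume "card V = 6" "s = 6"
        then have "t - 1 + card V = t + 5"
          using assms(2) by simp
        note iso[unfolded this]
        then show ?thesis
          using \<open>s = 6\<close> by simp
      qed
    next
      fix U V assume V: "finite V" "V \<subseteq> {1..n} - Z" "U \<subseteq> V"
        "\<F> = (\<union>) Z ` {e \<in> [V]\<^bsup>2\<^esup>. e \<inter> U \<noteq> {}}"
        and card: "card U = 2" "card V = s + 3" "s \<noteq> 1" "s \<noteq> 3"
      have disj: "V \<inter> Z = {}" "U \<inter> Z = {}"
        using V(2,3) by blast+
      have F_eq: "\<F> = {F \<in> [Z \<union> V]\<^bsup>(t + 1)\<^esup>. Z \<subseteq> F \<and> t \<le> card (F \<inter> (Z \<union> U))}"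
        unfolding V(4) by (rule sunflower_image[OF Z(1,2) V(1) disj(1) V(3)])
      have "card (Z \<union> V) = t + s + 2" "card (Z \<union> U) = t + 1"
        using card V(1) finite_subset[OF V(3,1)] Z(1,2) disj by (simp_all add: card_Un_disjoint Int_commute)
      moreover have "card Z = t - 1"
        using Z(2) by simp
      moreover have "Z \<union> U \<subseteq> Z \<union> V" "Z \<union> V \<subseteq> {1..n}"
        using V(2,3) Z(3) by blast+
      ultimately have "family_iso n \<F>
          {F \<in> [{1..t+s+2}]\<^bsup>(t + 1)\<^esup>. {1..t-1} \<subseteq> F \<and> card (F \<inter> {1..t+1}) \<ge> t}"
        unfolding F_eq using family_iso_initial_segments[of Z "Z \<union> U" "Z \<union> V" n "t + 1" t] by simp
      then show ?thesis
        using card by simp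
    qed auto
  next
    assume all: "\<forall>G\<in>\<F>. G \<subseteq> A \<union> B"
    define Y where "Y = A \<union> B"
    have Y: "finite Y" "card Y = t + 3" "Y \<subseteq> {1..n}"
      using finAB AB1 AB_n card_Un_Int[of A B] by (auto simp: Y_def)
    define E where "E = (-) Y ` \<F>"
    have E: "E \<subseteq> [Y]\<^bsup>2\<^esup>"
    proof
      fix e assume "e \<in> E"
      then obtain G where G: "e = Y - G" "G \<in> \<F>" by (auto simp: E_def)
      then have "G \<subseteq> Y" "finite G" "card G = t + 1"
        using all uniform by (auto simp: Y_def)
      then show "e \<in> [Y]\<^bsup>2\<^esup>"
        using G Y by (auto simp: nsets_def card_Diff_subset)
    qed
    have "Y - (Y - G) = G" if "G \<in> \<F>" for G
      using all that by (auto simp: Y_def)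
    then have F: "\<F> = (-) Y ` E"
      by (simp add: E_def image_image)
    note tr = dual_transfer[OF Y(1,2) E assms(2)]
    show ?thesis
    proof (rule cls[OF tr(1) E F tr(2)])
      fix V assume V: "finite V" "V \<subseteq> Y" "\<F> = (-) Y ` [V]\<^bsup>2\<^esup>"
        and cases: "card V = 4 \<and> s = 1 \<or> card V = 5 \<and> s = 3 \<or> card V = 6 \<and> s = 6"
      have F_eq: "\<F> = {F \<in> [Y]\<^bsup>(t + 1)\<^esup>. Y - V \<subseteq> F}"
        unfolding V(3) by (rule dual_complete_image[OF Y(1,2) V(2)])
      have "card (Y - V) = t + 3 - card V"
        using Y V by (simp add: card_Diff_subset)
      then have iso: "family_iso n \<F> {F \<in> [{1..t + 3}]\<^bsup>(t + 1)\<^esup>. {1..t + 3 - card V} \<subseteq> F}"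
        unfolding F_eq using family_iso_two_initial_segments[of "Y - V" Y n "t + 1"] Y(2,3) by simp
      \<comment> \<open>The side conditions \<open>t \<ge> 2\<close> and \<open>t \<ge> 3\<close>
        express that \<open>V\<close> fits into \<open>Y\<close>; \<open>t \<ge> s\<close> arises
        likewise in the double star case.\<close>
      have card_le: "card V \<le> t + 3"
        using card_mono[OF Y(1) V(2)] Y(2) by simp
      from cases show ?thesis
      proof (elim disjE conjE)
        \<comment> \<open>On four vertices the dual construction leads to the same family (i) as the
          sunflower one.\<close>
        assume "card V = 4" "s = 1"
        then have "t + 3 - card V = t - 1" "4 \<le> t + 3"
          using card_le by simp_all
        note iso[unfolded this(1)]
        then show ?thesis
          using \<open>s = 1\<close> \<open>4 \<le> t + 3\<close> by simp
      next
        assume "card V = 5" "s = 3"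
        then have "t + 3 - card V = t - 2" "5 \<le> t + 3"
          using card_le by simp_all
        note iso[unfolded this(1)]
        then show ?thesis
          using \<open>s = 3\<close> \<open>5 \<le> t + 3\<close> by simp
      next
        assume "card V = 6" "s = 6"
        then have "t + 3 - card V = t - 3" "6 \<le> t + 3"
          using card_le by simp_all
        note iso[unfolded this(1)]
        then show ?thesis
          using \<open>s = 6\<close> \<open>6 \<le> t + 3\<close> by simp
      qed
    next
      fix U V assume V: "finite V" "V \<subseteq> Y" "U \<subseteq> V"
        "\<F> = (-) Y ` {e \<in> [V]\<^bsup>2\<^esup>. e \<inter> U \<noteq> {}}"
        and card: "card U = 2" "card V = s + 3" "s \<noteq> 1" "s \<noteq> 3"
      have F_eq: "\<F> = {F \<in> [Y]\<^bsup>(t + 1)\<^esup>. Y - V \<subseteq> F \<and> t \<le> card (F \<inter> (Y - U))}"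
        unfolding V(4) by (rule dual_image[OF Y(1,2) V(2,3) card(1)])
      have "card (Y - V) = t - s"
        using Y(2) V(1,2) card by (simp add: card_Diff_subset)
      moreover have "card (Y - U) = t + 1"
        using Y(2) V(1,2,3) card finite_subset[OF V(3,1)] by (subst card_Diff_subset) auto
      ultimately have "family_iso n \<F>
          {F \<in> [{1..t+3}]\<^bsup>(t + 1)\<^esup>. {1..t-s} \<subseteq> F \<and> card (F \<inter> {1..t+1}) \<ge> t}"
        unfolding F_eq using family_iso_initial_segments[of "Y - V" "Y - U" Y n "t + 1" t] Y(2,3)
          Diff_mono[OF order_refl V(3)] by simp
      moreover have "s \<le> t"
        using card_mono[OF Y(1) V(2)] Y(2) card(2) by simp
      ultimately show ?thesis
        using card by simp
    qed
  qed
qed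

end
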